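(* Let $f$ be a continuous convex real-valued function defined on a closed interval $I:=[a,b]\subset\mathbb{R}$, and let $g$ be an arbitrary non-negative and integrable function on $I$. Then $$2f\left(\frac{a+b}{2}\right)\int_a^b g(t)\,dt\le\int_a^b \bigl(g(t)+g(a+b-t)\bigr)f(t)\,dt\le \bigl(f(a)+f(b)\bigr)\int_a^b g(t)\,dt.$$
   Context: A function $\phi$ on an interval is called convex if $\frac{\phi(x)+\phi(y)}{2}\ge \phi\left(\frac{x+y}{2}\right)$ for all $x,y$ in the interval; for continuous functions this is equivalent to the usual notion of convexity. *)

theory Defs
  imports "HOL-Analysis.Analysis"
begin

text \<open>Convexity in the sense of Jensen. Only midpoints are tested, so without continuity this is
  weaker than the library's \<^const>\<open>convex_on\<close>. Intended for intervals, where midpoints of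
  points of \<open>I\<close> stay in \<open>I\<close>.\<close>

definition midpoint_convex_on :: "real set \<Rightarrow> (real \<Rightarrow> real) \<Rightarrow> bool" where
  "midpoint_convex_on I \<phi> \<longleftrightarrow>
     (\<forall>x\<in>I. \<forall>y\<in>I. (\<phi> x + \<phi> y) / 2 \<ge> \<phi> ((x + y) / 2))"

end

theory Submission
  imports Defs
begin

text \<open>Reflecting \<^term>\<open>t\<close> to \<^term>\<open>a + b - t\<close> preserves Lebesgue measure on the interval, so the
  reflection can be moved from \<^term>\<open>g\<close> to \<^term>\<open>f\<close>: the integral in the middle equals that of
  \<^term>\<open>g t * (f t + f (a + b - t))\<close> (\<open>set_integral_reflect\<close>). As \<^term>\<open>g\<close> is
  non-negative, both inequalities then follow by integrating the pointwise bounds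
  \<^term>\<open>2 * f ((a + b) / 2) \<le> f t + f (a + b - t)\<close> and
  \<^term>\<open>f t + f (a + b - t) \<le> f a + f b\<close>.

  The first of these is midpoint convexity at the pair \<open>t\<close>, \<open>a + b - t\<close>. For the second, the
  symmetrisation \<open>t \<mapsto> f t + f (a + b - t)\<close> is again continuous and midpoint convex, and it takes
  the value \<^term>\<open>f a + f b\<close> at both endpoints; the maximum principle
  \<open>midpoint_convex_on_le_max\<close> says that it is nowhere larger.\<close>

text \<open>At a leftmost maximum point inside the interval, symmetric neighbours at distance \<open>d\<close> have a
  mean at least the maximum; so both are maximum points, and one of them lies further left.
  Continuity provides a leftmost maximum point in the first place.\<close>

lemma midpoint_convex_on_le_max:
  assumes cont: "continuous_on {a..b} \<phi>" and conv: "midpoint_convex_on {a..b} \<phi>"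
    and t: "t \<in> {a..b}"
  shows "\<phi> t \<le> max (\<phi> a) (\<phi> b)"
proof -
  obtain m where m: "m \<in> {a..b}" and m_max: "\<And>s. s \<in> {a..b} \<Longrightarrow> \<phi> s \<le> \<phi> m"
    using continuous_attains_sup[OF compact_Icc _ cont] t by (metis empty_iff)
  define S where "S = {s \<in> {a..b}. \<phi> s = \<phi> m}"
  have "closed S"
    unfolding S_def by (rule continuous_closed_preimage_constant[OF cont closed_atLeastAtMost])
  moreover have "bounded S"
    by (rule bounded_subset[OF bounded_closed_interval[of a b]]) (auto simp: S_def)
  moreover have "S \<noteq> {}"
    using m by (auto simp: S_def)
  ultimately obtain l where l: "l \<in> S" and l_min: "\<And>s. s \<in> S \<Longrightarrow> l \<le> s"
    using compact_attains_inf[of S] by (metis compact_eq_bounded_closed)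
  have l_ab: "a \<le> l" "l \<le> b" and \<phi>l: "\<phi> l = \<phi> m"
    using l by (auto simp: S_def)
  have "l = a \<or> l = b"
  proof (rule ccontr)
    assume interior: "\<not> (l = a \<or> l = b)"
    define d where "d = min (l - a) (b - l)"
    have d: "0 < d" "l - d \<in> {a..b}" "l + d \<in> {a..b}"
      using interior l_ab by (auto simp: d_def)
    have "\<phi> (((l - d) + (l + d)) / 2) \<le> (\<phi> (l - d) + \<phi> (l + d)) / 2"
      using conv d(2,3) unfolding midpoint_convex_on_def by blast
    then have "\<phi> l \<le> (\<phi> (l - d) + \<phi> (l + d)) / 2"
      by simp
    with m_max[OF d(2)] m_max[OF d(3)] \<phi>l have "\<phi> (l - d) = \<phi> m"
      by simp
    with d(2) have "l - d \<in> S"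
      by (simp add: S_def)
    from l_min[OF this] d(1) show False
      by simp
  qed
  with m_max[OF t] \<phi>l show ?thesis
    by auto
qed

lemma reflect_mem_Icc_iff:
  fixes a b t :: real
  shows "a + b - t \<in> {a..b} \<longleftrightarrow> t \<in> {a..b}"
  by auto

lemma continuous_on_reflect:
  fixes f :: "real \<Rightarrow> real"
  assumes "continuous_on {a..b} f"
  shows "continuous_on {a..b} (\<lambda>t. f (a + b - t))"
  by (rule continuous_on_compose2[OF assms]) (auto intro!: continuous_intros)

lemma midpoint_convex_on_reflect:
  assumes "midpoint_convex_on {a..b} f"
  shows "midpoint_convex_on {a..b} (\<lambda>t. f (a + b - t))"
  unfolding midpoint_convex_on_def
proof (intro ballI)
  fix x y assume "x \<in> {a..b}" "y \<in> {a..b}"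
  then have "f (((a + b - x) + (a + b - y)) / 2) \<le> (f (a + b - x) + f (a + b - y)) / 2"
    using assms unfolding midpoint_convex_on_def by (metis reflect_mem_Icc_iff)
  moreover have "((a + b - x) + (a + b - y)) / 2 = a + b - (x + y) / 2"
    by (simp add: field_simps)
  ultimately show "f (a + b - (x + y) / 2) \<le> (f (a + b - x) + f (a + b - y)) / 2"
    by (simp only:)
qed

lemma midpoint_convex_on_add:
  assumes "midpoint_convex_on I f" "midpoint_convex_on I h"
  shows "midpoint_convex_on I (\<lambda>t. f t + h t)"
  using assms unfolding midpoint_convex_on_def by (fastforce simp: field_simps)

lemma midpoint_convex_symmetrisation_lower:
  assumes "midpoint_convex_on {a..b} f" and "t \<in> {a..b}"
  shows "2 * f ((a + b) / 2) \<le> f t + f (a + b - t)"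
proof -
  have "f ((t + (a + b - t)) / 2) \<le> (f t + f (a + b - t)) / 2"
    using assms unfolding midpoint_convex_on_def by (metis reflect_mem_Icc_iff)
  then show ?thesis
    by simp
qed

lemma midpoint_convex_symmetrisation_upper:
  assumes "continuous_on {a..b} f" and "midpoint_convex_on {a..b} f" and "t \<in> {a..b}"
  shows "f t + f (a + b - t) \<le> f a + f b"
  using midpoint_convex_on_le_max[OF
      continuous_on_add[OF assms(1) continuous_on_reflect[OF assms(1)]]
      midpoint_convex_on_add[OF assms(2) midpoint_convex_on_reflect[OF assms(2)]] assms(3)]
  by (simp add: add.commute)

text \<open>The indicator of the interval is invariant under the reflection, so the affine change of
  variables on the whole line, with slope of modulus 1, restricts to the interval.\<close>

lemma has_bochner_integral_indicator_reflect:
  fixes h :: "real \<Rightarrow> real"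
  assumes "set_integrable lebesgue {a..b} h"
  shows "has_bochner_integral lebesgue (\<lambda>t. indicator {a..b} t *\<^sub>R h (a + b - t))
           (LINT t:{a..b}|lebesgue. h t)"
proof -
  have "has_bochner_integral lebesgue (\<lambda>t. indicator {a..b} t *\<^sub>R h t)
          (LINT t:{a..b}|lebesgue. h t)"
    using assms unfolding set_integrable_def set_lebesgue_integral_def
    by (rule has_bochner_integral_integrable)
  then have "has_bochner_integral lebesgue
      (\<lambda>t. indicator {a..b} (a + b + - 1 * t) *\<^sub>R h (a + b + - 1 * t))
      ((LINT t:{a..b}|lebesgue. h t) /\<^sub>R \<bar>- 1\<bar>)"
    by (subst (asm) has_bochner_integral_lebesgue_real_affine_iff[of "- 1" _ _ "a + b"]) simp_all
  moreover have "indicator {a..b} (a + b - t) = (indicator {a..b} t :: real)" for t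
    by (simp only: indicator_def reflect_mem_Icc_iff)
  ultimately show ?thesis
    by simp
qed

lemma set_integrable_reflect:
  fixes h :: "real \<Rightarrow> real"
  assumes "set_integrable lebesgue {a..b} h"
  shows "set_integrable lebesgue {a..b} (\<lambda>t. h (a + b - t))"
  using has_bochner_integral_indicator_reflect[OF assms]
  by (simp add: set_integrable_def has_bochner_integral_iff)

lemma set_integral_reflect:
  fixes h :: "real \<Rightarrow> real"
  assumes "set_integrable lebesgue {a..b} h"
  shows "(LINT t:{a..b}|lebesgue. h (a + b - t)) = (LINT t:{a..b}|lebesgue. h t)"
  using has_bochner_integral_indicator_reflect[OF assms]
  by (simp add: set_lebesgue_integral_def has_bochner_integral_iff)

lemma set_integrable_mult_continuous:
  fixes f g :: "real \<Rightarrow> real"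
  assumes "set_integrable lebesgue {a..b} g" and "continuous_on {a..b} f"
  shows "set_integrable lebesgue {a..b} (\<lambda>t. g t * f t)"
proof -
  have "f \<in> borel_measurable (lebesgue_on {a..b})"
    by (rule continuous_imp_measurable_on_sets_lebesgue[OF assms(2)]) simp
  moreover have "bounded (f ` {a..b})"
    by (intro compact_imp_bounded compact_continuous_image assms(2) compact_Icc)
  ultimately have "set_integrable lebesgue {a..b} (\<lambda>t. f t * g t)"
    by (intro absolutely_integrable_bounded_measurable_product[of "(*)"] assms(1))
       (auto simp: bilinear_times)
  then show ?thesis
    by (simp add: mult.commute)
qed

theorem propositionY:
  fixes f g :: "real \<Rightarrow> real" and a b :: real
  assumes "a \<le> b"
    and "continuous_on {a..b} f"
    and "midpoint_convex_on {a..b} f"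
    and "\<And>t. t \<in> {a..b} \<Longrightarrow> 0 \<le> g t"
    and "set_integrable lebesgue {a..b} g"
  shows "2 * f ((a + b) / 2) * (LINT t:{a..b}|lebesgue. g t)
           \<le> (LINT t:{a..b}|lebesgue. (g t + g (a + b - t)) * f t)
       \<and> (LINT t:{a..b}|lebesgue. (g t + g (a + b - t)) * f t)
           \<le> (f a + f b) * (LINT t:{a..b}|lebesgue. g t)"
proof -
  note gf = set_integrable_mult_continuous[OF assms(5,2)]
  note gfr = set_integrable_mult_continuous[OF assms(5) continuous_on_reflect[OF assms(2)]]
  have grf: "set_integrable lebesgue {a..b} (\<lambda>t. g (a + b - t) * f t)"
    using set_integrable_reflect[OF gfr] by simp
  have sym: "set_integrable lebesgue {a..b} (\<lambda>t. g t * (f t + f (a + b - t)))"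
    using set_integral_add(1)[OF gf gfr] by (simp add: distrib_left)
  have "(LINT t:{a..b}|lebesgue. (g t + g (a + b - t)) * f t)
      = (LINT t:{a..b}|lebesgue. g t * f t) + (LINT t:{a..b}|lebesgue. g (a + b - t) * f t)"
    using set_integral_add(2)[OF gf grf] by (simp add: distrib_right)
  also have "(LINT t:{a..b}|lebesgue. g (a + b - t) * f t)
      = (LINT t:{a..b}|lebesgue. g t * f (a + b - t))"
    using set_integral_reflect[OF gfr] by simp
  also have "(LINT t:{a..b}|lebesgue. g t * f t) + \<dots>
      = (LINT t:{a..b}|lebesgue. g t * (f t + f (a + b - t)))"
    using set_integral_add(2)[OF gf gfr] by (simp add: distrib_left)
  finally have middle: "(LINT t:{a..b}|lebesgue. (g t + g (a + b - t)) * f t)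
      = (LINT t:{a..b}|lebesgue. g t * (f t + f (a + b - t)))" .
  have const: "set_integrable lebesgue {a..b} (\<lambda>t. g t * c)" for c
    using assms(5) by simp
  have "(LINT t:{a..b}|lebesgue. g t * (2 * f ((a + b) / 2)))
      \<le> (LINT t:{a..b}|lebesgue. g t * (f t + f (a + b - t)))"
    by (intro set_integral_mono const sym mult_left_mono assms(4)
        midpoint_convex_symmetrisation_lower[OF assms(3)])
  moreover have "(LINT t:{a..b}|lebesgue. g t * (f t + f (a + b - t)))
      \<le> (LINT t:{a..b}|lebesgue. g t * (f a + f b))"
    by (intro set_integral_mono const sym mult_left_mono assms(4)
        midpoint_convex_symmetrisation_upper[OF assms(2,3)])
  ultimately show ?thesis
    unfolding middle set_integral_mult_left by (simp add: mult.commute)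
qed

end
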